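(* Let $p\in(0,1)$ be arbitrary. For the zero-temperature Glauber dynamics on the slab $S_4=\mathbb{Z}^2\times\{0,1,2,3\}$ with periodic boundary conditions in the third coordinate, started from the i.i.d. product measure with density $p$ of $+1$ spins, almost surely some sites do not fixate; that is, with $\mathbb{P}_p$-probability one there exists a vertex $v\in S_4$ for which there is no $T<\infty$ with $\sigma_v(t)=\sigma_v(T)$ for all $t\ge T$.
   Context: Slab with periodic boundary conditions: the vertex set of $S_4$ is $\mathbb{Z}^2\times\{0,1,2,3\}$; two vertices are neighbors if they are at $\ell_1$-distance $1$, and in addition $(x,y,3)$ and $(x,y,0)$ are neighbors for every $(x,y)\in\mathbb{Z}^2$. So every vertex has exactly six neighbors. Let $\mathcal{E}_4$ be the edge set. Dynamics: spins are $\sigma_v(t)\in\{-1,+1\}$, $v\in S_4$, $t\ge 0$. The initial spins $\sigma_v(0)$ are i.i.d. with probability $p$ of being $+1$ and $1-p$ of being $-1$. Each vertex has an independent rate-one exponential clock (Poisson process). The energy of $v$ at time $t$ is $e_v(t)=-\sum_{w:\{v,w\}\in\mathcal{E}_4}\sigma_v(t)\sigma_w(t)$. When the clock at $v$ rings at time $t$, the spin at $v$ is updated: $\sigma_v(t)=-\sigma_v(t^-)$ if $e_v(t^-)>0$; $\sigma_v(t)=\pm1$ with probability $1/2$ each (independent fair coin) if $e_v(t^-)=0$; $\sigma_v(t)=\sigma_v(t^-)$ if $e_v(t^-)<0$. $\mathbb{P}_p$ denotes the joint law of the initial spins and the dynamics realization $\omega$ (clocks and coins). *)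

theory Defs
  imports "HOL-Probability.Probability"
begin

type_synonym site = "int \<times> int \<times> int"

definition S4 :: "site set" where
  "S4 = UNIV \<times> UNIV \<times> {0, 1, 2, 3}"

definition adj :: "site \<Rightarrow> site \<Rightarrow> bool" where
  "adj v w \<longleftrightarrow> v \<in> S4 \<and> w \<in> S4 \<and>
    (case v of (x, y, z) \<Rightarrow> case w of (x', y', z') \<Rightarrow>
      \<bar>x - x'\<bar> + \<bar>y - y'\<bar> + \<bar>z - z'\<bar> = 1 \<or>
      (x = x' \<and> y = y' \<and> ((z = 3 \<and> z' = 0) \<or> (z = 0 \<and> z' = 3))))"

definition spin_measure :: "real \<Rightarrow> int measure" where
  "spin_measure p = measure_pmf (map_pmf (\<lambda>b. if b then 1 else -1) (bernoulli_pmf p))"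

text \<open>
  A realization consists of the initial spins, the waiting times between successive rings of
  each clock, and the coins; the coin with index \<open>(v, n)\<close> belongs to ring number \<open>n\<close> of the
  clock at \<open>v\<close> (counted from 0). A rate-one Poisson process is represented by its i.i.d.
  exponential waiting times.
\<close>

type_synonym realization = "(site \<Rightarrow> int) \<times> (site \<times> nat \<Rightarrow> real) \<times> (site \<times> nat \<Rightarrow> int)"

definition initial_spin :: "realization \<Rightarrow> site \<Rightarrow> int" where
  "initial_spin \<omega> v = fst \<omega> v"

definition ring_time :: "realization \<Rightarrow> site \<Rightarrow> nat \<Rightarrow> real" where
  "ring_time \<omega> v n = (\<Sum>k\<le>n. fst (snd \<omega>) (v, k))"

definition coin :: "realization \<Rightarrow> site \<Rightarrow> nat \<Rightarrow> int" where
  "coin \<omega> v n = snd (snd \<omega>) (v, n)"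

definition glauber_measure :: "real \<Rightarrow> realization measure" where
  "glauber_measure p =
    (\<Pi>\<^sub>M v\<in>S4. spin_measure p) \<Otimes>\<^sub>M
    ((\<Pi>\<^sub>M i\<in>S4 \<times> (UNIV :: nat set). density lborel (\<lambda>x. ennreal (exponential_density 1 x))) \<Otimes>\<^sub>M
     (\<Pi>\<^sub>M i\<in>S4 \<times> (UNIV :: nat set). spin_measure (1 / 2)))"

definition energy :: "(site \<Rightarrow> int) \<Rightarrow> site \<Rightarrow> int" where
  "energy \<eta> v = - (\<Sum>w | adj v w. \<eta> v * \<eta> w)"

definition before :: "(real \<Rightarrow> site \<Rightarrow> int) \<Rightarrow> real \<Rightarrow> site \<Rightarrow> int" where
  "before \<sigma> t v = Lim (at_left t) (\<lambda>s. \<sigma> s v)"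

definition update :: "(site \<Rightarrow> int) \<Rightarrow> int \<Rightarrow> site \<Rightarrow> int" where
  "update \<eta> c v =
    (if energy \<eta> v > 0 then - \<eta> v else if energy \<eta> v = 0 then c else \<eta> v)"

text \<open>
  \<open>\<sigma>\<close> is a trajectory of the zero-temperature dynamics driven by \<open>\<omega>\<close>: the spin at \<open>v\<close> is
  constant between rings of its own clock and is updated at these rings according to the
  configuration just before the ring. Values at negative times and outside \<open>S4\<close> are
  irrelevant. By Harris' graphical construction, almost every \<open>\<omega>\<close> has exactly one such
  trajectory (on \<open>S4\<close> and nonnegative times).
\<close>

definition glauber_trajectory :: "realization \<Rightarrow> (real \<Rightarrow> site \<Rightarrow> int) \<Rightarrow> bool" where
  "glauber_trajectory \<omega> \<sigma> \<longleftrightarrow> (\<forall>v\<in>S4.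
     \<sigma> 0 v = initial_spin \<omega> v \<and>
     (\<forall>s t. 0 \<le> s \<and> s \<le> t \<and> (\<forall>n. ring_time \<omega> v n \<notin> {s<..t}) \<longrightarrow> \<sigma> t v = \<sigma> s v) \<and>
     (\<forall>n. \<sigma> (ring_time \<omega> v n) v = update (before \<sigma> (ring_time \<omega> v n)) (coin \<omega> v n) v))"

definition fixates :: "(real \<Rightarrow> site \<Rightarrow> int) \<Rightarrow> site \<Rightarrow> bool" where
  "fixates \<sigma> v \<longleftrightarrow> (\<exists>T\<ge>0. \<forall>t\<ge>T. \<sigma> t v = \<sigma> T v)"

end

theory Submission
  imports Defs
begin

text \<open>
  There is a finite pattern of initial spins that by itself prevents fixation. All of its sites but
  a few are frozen forever, since each agrees with at least four of its six neighbours and these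
  are frozen as well. Among the other sites is a segment between a frozen plus and a frozen minus
  in which the influences from all other neighbours cancel. If every site had fixated, then some
  site of the segment would disagree with one of its two neighbours on the line, so its energy
  would be nonnegative; at the infinitely many later rings of its clock it would flip, or follow
  its coin, which shows both signs infinitely often. Since the pattern has positive probability
  and disjoint translates are independent, almost surely it occurs somewhere.
\<close>

section \<open>Independent blocks of coordinates\<close>

lemma sets_PiM_Ball:
  assumes "countable J" "J \<subseteq> I" "\<And>i. i \<in> J \<Longrightarrow> A i \<in> sets (M i)"
  shows "{x \<in> space (Pi\<^sub>M I M). \<forall>i\<in>J. x i \<in> A i} \<in> sets (Pi\<^sub>M I M)"
proof (rule sets.sets_Collect_countable_All'[OF _ assms(1)])
  fix i assume "i \<in> J"
  then show "{x \<in> space (Pi\<^sub>M I M). x i \<in> A i} \<in> sets (Pi\<^sub>M I M)"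
    using assms by (intro sets_Collect_single) auto
qed

text \<open>
  The additional conditions on \<open>K\<close> make the induction work: the event that the conditions on the
  next block hold is subtracted, with that block merged into \<open>K\<close>.
\<close>

lemma (in product_prob_space) measure_avoid_blocks:
  fixes J :: "nat \<Rightarrow> 'i set"
  assumes "K \<subseteq> I" "finite K" "\<And>n. J n \<subseteq> I" "\<And>n. finite (J n)"
    and "disjoint_family J" "\<And>n. n < N \<Longrightarrow> J n \<inter> K = {}"
    and A: "\<And>i. i \<in> I \<Longrightarrow> A i \<in> sets (M i)"
  shows "measure (Pi\<^sub>M I M)
      {x \<in> space (Pi\<^sub>M I M). (\<forall>i\<in>K. x i \<in> A i) \<and> (\<forall>n<N. \<exists>i\<in>J n. x i \<notin> A i)} =
    (\<Prod>i\<in>K. measure (M i) (A i)) * (\<Prod>n<N. 1 - (\<Prod>i\<in>J n. measure (M i) (A i)))"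
  using assms(1,2,6)
proof (induction N arbitrary: K)
  case 0
  have "emeasure (Pi\<^sub>M I M) {x \<in> space (Pi\<^sub>M I M). \<forall>i\<in>K. x i \<in> A i} = (\<Prod>i\<in>K. emeasure (M i) (A i))"
    using 0 A by (intro emeasure_PiM_Collect) auto
  then show ?case
    by (simp add: emeasure_eq_measure M.emeasure_eq_measure prod_ennreal prod_nonneg)
next
  case (Suc N)
  let ?B = "\<lambda>K N. {x \<in> space (Pi\<^sub>M I M). (\<forall>i\<in>K. x i \<in> A i) \<and> (\<forall>n<N. \<exists>i\<in>J n. x i \<notin> A i)}"
  have meas: "?B K N \<in> sets (Pi\<^sub>M I M)" if "K \<subseteq> I" "finite K" for K N
  proof -
    let ?E = "\<lambda>J. {x \<in> space (Pi\<^sub>M I M). \<forall>i\<in>J. x i \<in> A i}"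
    have "?E J' \<in> sets (Pi\<^sub>M I M)" if "finite J'" "J' \<subseteq> I" for J'
      using that A by (intro sets_PiM_Ball countable_finite) auto
    then have "?E K - (\<Union>n<N. ?E (J n)) \<in> sets (Pi\<^sub>M I M)"
      using that assms(3,4) by (intro sets.Diff sets.finite_UN) simp_all
    moreover have "?B K N = ?E K - (\<Union>n<N. ?E (J n))" by auto
    ultimately show ?thesis by simp
  qed
  have eq: "?B K (Suc N) = ?B K N - ?B (K \<union> J N) N"
    by (auto simp: less_Suc_eq)
  have disj: "J n \<inter> (K \<union> J N) = {}" if "n < N" for n
    using Suc.prems(3)[of n] disjoint_family_onD[OF assms(5), of n N] that
    by (simp add: Int_Un_distrib)
  have "measure (Pi\<^sub>M I M) (?B K (Suc N)) =
      measure (Pi\<^sub>M I M) (?B K N) - measure (Pi\<^sub>M I M) (?B (K \<union> J N) N)"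
    unfolding eq using assms(3,4) Suc.prems by (intro finite_measure_Diff meas) auto
  also have "measure (Pi\<^sub>M I M) (?B K N) =
      (\<Prod>i\<in>K. measure (M i) (A i)) * (\<Prod>n<N. 1 - (\<Prod>i\<in>J n. measure (M i) (A i)))"
    using Suc.prems by (intro Suc.IH) auto
  also have "measure (Pi\<^sub>M I M) (?B (K \<union> J N) N) =
      (\<Prod>i\<in>K \<union> J N. measure (M i) (A i)) * (\<Prod>n<N. 1 - (\<Prod>i\<in>J n. measure (M i) (A i)))"
    using Suc.prems assms(3,4) disj by (intro Suc.IH) auto
  also have "(\<Prod>i\<in>K \<union> J N. measure (M i) (A i)) =
      (\<Prod>i\<in>K. measure (M i) (A i)) * (\<Prod>i\<in>J N. measure (M i) (A i))"
    using Suc.prems assms(4) by (intro prod.union_disjoint) auto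
  finally show ?case by (simp add: algebra_simps)
qed

text \<open>Disjoint blocks are independent and each succeeds with probability at least
  \<open>q\<close>. So the first \<open>N\<close> blocks all fail with probability at most
  \<open>(1 - q) ^ N\<close>, which tends to 0.\<close>

lemma (in product_prob_space) AE_ex_block:
  fixes J :: "nat \<Rightarrow> 'i set"
  assumes "\<And>n. J n \<subseteq> I" "\<And>n. finite (J n)" "disjoint_family J"
    and A: "\<And>i. i \<in> I \<Longrightarrow> A i \<in> sets (M i)"
    and q: "0 < q" "\<And>n. q \<le> (\<Prod>i\<in>J n. measure (M i) (A i))"
  shows "AE x in Pi\<^sub>M I M. \<exists>n. \<forall>i\<in>J n. x i \<in> A i"
proof -
  let ?B = "\<lambda>N. {x \<in> space (Pi\<^sub>M I M). \<forall>n<N. \<exists>i\<in>J n. x i \<notin> A i}"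
  let ?Z = "{x \<in> space (Pi\<^sub>M I M). \<forall>n. \<exists>i\<in>J n. x i \<notin> A i}"
  let ?E = "\<lambda>n. {x \<in> space (Pi\<^sub>M I M). \<forall>i\<in>J n. x i \<in> A i}"
  have mE: "?E n \<in> sets (Pi\<^sub>M I M)" for n
    using assms(1,2) A by (intro sets_PiM_Ball countable_finite) auto
  have B: "?B N = space (Pi\<^sub>M I M) - (\<Union>n<N. ?E n)" for N by auto
  have mB: "?B N \<in> sets (Pi\<^sub>M I M)" for N
    unfolding B using mE by (intro sets.Diff sets.top sets.finite_UN) simp_all
  have Z: "?Z = space (Pi\<^sub>M I M) - (\<Union>n. ?E n)" by auto
  have mZ: "?Z \<in> sets (Pi\<^sub>M I M)"
    unfolding Z using mE by (intro sets.Diff sets.top sets.countable_UN) auto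
  have p1: "(\<Prod>i\<in>J n. measure (M i) (A i)) \<le> 1" for n
    by (intro prod_le_1 conjI measure_nonneg M.prob_le_1)
  have le: "measure (Pi\<^sub>M I M) ?Z \<le> (1 - q) ^ N" for N
  proof -
    have "measure (Pi\<^sub>M I M) ?Z \<le> measure (Pi\<^sub>M I M) (?B N)"
      by (rule finite_measure_mono[OF _ mB]) blast
    also have "\<dots> = (\<Prod>n<N. 1 - (\<Prod>i\<in>J n. measure (M i) (A i)))"
      using measure_avoid_blocks[of "{}" J N A] assms(1-4) by simp
    also have "\<dots> \<le> (\<Prod>n<N. 1 - q)"
      using q(2) p1 by (intro prod_mono conjI diff_left_mono) (simp_all add: diff_ge_0_iff_ge)
    finally show ?thesis by simp
  qed
  have "q \<le> 1" using q(2)[of 0] p1[of 0] by linarith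
  then have "(\<lambda>N. (1 - q) ^ N) \<longlonglongrightarrow> 0"
    using q(1) by (intro LIMSEQ_realpow_zero) auto
  then have "measure (Pi\<^sub>M I M) ?Z \<le> 0"
    using le by (intro LIMSEQ_le_const) auto
  then have "measure (Pi\<^sub>M I M) ?Z = 0"
    using measure_nonneg[of "Pi\<^sub>M I M" ?Z] by linarith
  then have "?Z \<in> null_sets (Pi\<^sub>M I M)"
    using mZ by (auto simp: null_sets_def emeasure_eq_measure)
  then show ?thesis
    by (rule AE_I') auto
qed

text \<open>A second Borel-Cantelli lemma for single coordinates: the singleton blocks
  \<open>{j (n + m)}\<close> give, for each \<open>m\<close>, a success at an index of at least
  \<open>m\<close>.\<close>

lemma (in product_prob_space) AE_infinitely_often:
  fixes j :: "nat \<Rightarrow> 'i"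
  assumes "range j \<subseteq> I" "inj j"
    and A: "\<And>i. i \<in> I \<Longrightarrow> A i \<in> sets (M i)"
    and q: "0 < q" "\<And>n. q \<le> measure (M (j n)) (A (j n))"
  shows "AE x in Pi\<^sub>M I M. infinite {n. x (j n) \<in> A (j n)}"
proof -
  have "AE x in Pi\<^sub>M I M. \<exists>n. \<forall>i\<in>{j (n + m)}. x i \<in> A i" for m
    using assms(1) q
    by (intro AE_ex_block[where q = q] A) (auto simp: disjoint_family_on_def inj_eq[OF assms(2)])
  then have "AE x in Pi\<^sub>M I M. \<forall>m. \<exists>n. x (j (n + m)) \<in> A (j (n + m))"
    by (simp add: AE_all_countable)
  then show ?thesis
    by eventually_elim (metis (mono_tags, lifting) infinite_nat_iff_unbounded_le mem_Collect_eq le_add2)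
qed

section \<open>Almost sure properties of a realization\<close>

lemma
  assumes "0 \<le> p" "p \<le> 1"
  shows measure_spin_measure_1: "measure (spin_measure p) {1} = p"
    and measure_spin_measure_minus_1: "measure (spin_measure p) {-1} = 1 - p"
proof -
  have "(\<lambda>b. if b then 1 else - 1) -` {1 :: int} = {True}"
    "(\<lambda>b. if b then 1 else - 1) -` {- 1 :: int} = {False}" by (auto split: if_splits)
  then show "measure (spin_measure p) {1} = p" "measure (spin_measure p) {-1} = 1 - p"
    using assms by (simp_all add: spin_measure_def measure_pmf_single pmf_map)
qed

lemma sets_spin_measure [simp]: "sets (spin_measure p) = UNIV"
  by (simp add: spin_measure_def)

lemma prob_space_spin_measure: "prob_space (spin_measure p)"
  by (simp add: spin_measure_def prob_space_measure_pmf)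

lemma AE_spin_measure: "AE c in spin_measure p. c \<in> {-1, 1}"
  unfolding spin_measure_def by (subst AE_measure_pmf_iff) auto

interpretation waits: product_prob_space "\<lambda>i :: 'i. density lborel (\<lambda>x. ennreal (exponential_density 1 x))" I for I
proof -
  interpret prob_space "density lborel (\<lambda>x. ennreal (exponential_density 1 x))"
    by (rule prob_space_exponential_density) simp
  show "product_prob_space (\<lambda>i :: 'i. density lborel (\<lambda>x. ennreal (exponential_density 1 x)))"
    by unfold_locales
qed

interpretation spins: product_prob_space "\<lambda>i :: 'i. spin_measure p" I for I p
proof -
  interpret prob_space "spin_measure p"
    by (rule prob_space_spin_measure)
  show "product_prob_space (\<lambda>i :: 'i. spin_measure p)"
    by unfold_locales
qed

text \<open>The first projection maps the product measure to \<open>M\<close>, since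
  \<open>N\<close> has mass one, and null sets pull back along it.\<close>

lemma AE_pair_fst:
  assumes "prob_space M" "prob_space N" "AE x in M. P x"
  shows "AE z in M \<Otimes>\<^sub>M N. P (fst z)"
  using assms(3)
  by (intro AE_distrD[OF measurable_fst]) (simp only: prob_space.distr_pair_fst[OF assms(2)])

lemma AE_pair_snd:
  assumes "prob_space M" "prob_space N" "AE y in N. P y"
  shows "AE z in M \<Otimes>\<^sub>M N. P (snd z)"
proof (intro AE_distrD[OF measurable_snd])
  interpret M: prob_space M by fact
  interpret N: prob_space N by fact
  \<comment> \<open>The preimage of \<open>A\<close> is the rectangle
    \<open>space M \<times> A\<close>, and \<open>M\<close> has mass one.\<close>
  have "distr (M \<Otimes>\<^sub>M N) N snd = N"
  proof (rule measure_eqI)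
    fix A assume "A \<in> sets (distr (M \<Otimes>\<^sub>M N) N snd)"
    then have A: "A \<in> sets N" by simp
    then have "snd -` A \<inter> space (M \<Otimes>\<^sub>M N) = space M \<times> A"
      using sets.sets_into_space[OF A] by (auto simp: space_pair_measure)
    with A show "emeasure (distr (M \<Otimes>\<^sub>M N) N snd) A = emeasure N A"
      by (simp add: emeasure_distr N.emeasure_pair_measure_Times M.emeasure_space_1)
  qed simp
  with assms(3) show "AE y in distr (M \<Otimes>\<^sub>M N) N snd. P y" by (simp only:)
qed

text \<open>Lifts almost sure statements about one of the three independent ingredients to the whole
  realization.\<close>

lemma
  shows AE_glauber_spins: "(AE s in \<Pi>\<^sub>M v\<in>S4. spin_measure p. P s) \<Longrightarrow> AE \<omega> in glauber_measure p. P (fst \<omega>)"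
    and AE_glauber_waits: "(AE w in \<Pi>\<^sub>M i\<in>S4 \<times> (UNIV :: nat set). density lborel (\<lambda>x. ennreal (exponential_density 1 x)). Q w)
      \<Longrightarrow> AE \<omega> in glauber_measure p. Q (fst (snd \<omega>))"
    and AE_glauber_coins: "(AE c in \<Pi>\<^sub>M i\<in>S4 \<times> (UNIV :: nat set). spin_measure (1 / 2). R c)
      \<Longrightarrow> AE \<omega> in glauber_measure p. R (snd (snd \<omega>))"
proof -
  let ?S = "\<Pi>\<^sub>M v\<in>S4. spin_measure p"
  let ?W = "\<Pi>\<^sub>M i\<in>S4 \<times> (UNIV :: nat set). density lborel (\<lambda>x. ennreal (exponential_density 1 x))"
  let ?C = "\<Pi>\<^sub>M i\<in>S4 \<times> (UNIV :: nat set). spin_measure (1 / 2)"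
  have W: "prob_space ?W" and C: "prob_space ?C" and S: "prob_space ?S"
    by (rule waits.P.prob_space_axioms spins.P.prob_space_axioms)+
  have WC: "prob_space (?W \<Otimes>\<^sub>M ?C)" using W C by (rule prob_space_pair)
  show "AE \<omega> in glauber_measure p. P (fst \<omega>)" if "AE s in ?S. P s"
    unfolding glauber_measure_def by (intro AE_pair_fst S WC that)
  show "AE \<omega> in glauber_measure p. Q (fst (snd \<omega>))" if "AE w in ?W. Q w"
    unfolding glauber_measure_def
    by (rule AE_pair_snd[OF S WC]) (intro AE_pair_fst W C that)
  show "AE \<omega> in glauber_measure p. R (snd (snd \<omega>))" if "AE c in ?C. R c"
    unfolding glauber_measure_def
    by (rule AE_pair_snd[OF S WC]) (intro AE_pair_snd W C that)
qed

text \<open>Any \<open>m\<close> of the terms above 1 already contribute at least \<open>m\<close>,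
  so the partial sums are eventually above every bound.\<close>

lemma finite_partial_sums_le:
  fixes w :: "nat \<Rightarrow> real"
  assumes nonneg: "\<And>n. 0 \<le> w n" and inf: "infinite {n. 1 < w n}"
  shows "finite {n. (\<Sum>k\<le>n. w k) \<le> t}"
proof -
  obtain m :: nat where m: "t < real m" using reals_Archimedean2 by blast
  obtain F where F: "F \<subseteq> {n. 1 < w n}" "finite F" "card F = m"
    using infinite_arbitrarily_large[OF inf] by blast
  obtain N where N: "F \<subseteq> {..N}" using F(2) finite_nat_iff_bounded_le by blast
  have "t < (\<Sum>k\<le>n. w k)" if "N \<le> n" for n
  proof -
    have "real m \<le> (\<Sum>k\<in>F. w k)" using sum_mono[of F "\<lambda>_. 1" w] F by force
    also have "\<dots> \<le> (\<Sum>k\<le>n. w k)"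
      using N that nonneg by (intro sum_mono2) auto
    finally show ?thesis using m by simp
  qed
  then have "{n. (\<Sum>k\<le>n. w k) \<le> t} \<subseteq> {..<N}"
    by (metis (mono_tags, lifting) lessThan_iff linorder_not_less mem_Collect_eq subsetI)
  then show ?thesis using finite_subset by blast
qed

text \<open>Each waiting time exceeds 1 with probability \<open>exp (-1)\<close>, so for every clock
  infinitely many do, and rings cannot accumulate at a finite time.\<close>

lemma AE_finite_rings:
  "AE \<omega> in glauber_measure p. \<forall>v\<in>S4. \<forall>t. finite {n. ring_time \<omega> v n \<le> t}"
proof -
  let ?E = "density lborel (\<lambda>x. ennreal (exponential_density 1 x))"
  let ?I = "S4 \<times> (UNIV :: nat set)"
  have E: "prob_space ?E"
    by (rule prob_space_exponential_density) simp
  have nonneg: "AE x in ?E. 0 \<le> x"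
    by (subst AE_density) (auto simp: exponential_density_def)
  have "AE w in \<Pi>\<^sub>M i\<in>?I. ?E. \<forall>i\<in>?I. 0 \<le> w i"
    by (subst AE_ball_countable) (auto intro!: waits.AE_component nonneg)
  moreover have tail: "measure ?E {1<..} = exp (-1)"
  proof -
    have "distributed ?E lborel (\<lambda>x. x) (\<lambda>x. ennreal (exponential_density 1 x))"
      by (auto simp: distributed_def distr_id2 intro!: distr_cong)
    from prob_space.exponential_distributedD_gt[OF E this, of 1] show ?thesis
      by (simp add: greaterThan_def)
  qed
  then have "AE w in \<Pi>\<^sub>M i\<in>?I. ?E. infinite {n. w (v, n) \<in> {1<..}}" if "v \<in> S4" for v
    using that by (intro waits.AE_infinitely_often[where q = "exp (-1)"]) (auto simp: inj_def tail)
  then have "AE w in \<Pi>\<^sub>M i\<in>?I. ?E. \<forall>v\<in>S4. infinite {n. 1 < w (v, n)}"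
    by (subst AE_ball_countable) auto
  ultimately have "AE w in \<Pi>\<^sub>M i\<in>?I. ?E. \<forall>v\<in>S4. \<forall>t. finite {n. (\<Sum>k\<le>n. w (v, k)) \<le> t}"
    by eventually_elim (auto intro!: finite_partial_sums_le)
  from AE_glauber_waits[OF this] show ?thesis
    by (simp add: ring_time_def)
qed

lemma AE_coins:
  "AE \<omega> in glauber_measure p. \<forall>v\<in>S4. (\<forall>n. coin \<omega> v n \<in> {-1, 1}) \<and>
    infinite {n. coin \<omega> v n = -1} \<and> infinite {n. coin \<omega> v n = 1}"
proof -
  let ?I = "S4 \<times> (UNIV :: nat set)"
  let ?M = "\<Pi>\<^sub>M i\<in>?I. spin_measure (1 / 2)"
  have "AE w in ?M. \<forall>i\<in>?I. w i \<in> {-1, 1}"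
    by (subst AE_ball_countable) (auto intro!: spins.AE_component AE_spin_measure simp del: insert_iff)
  moreover have "AE w in ?M. infinite {n. w (v, n) \<in> {c}}" if "v \<in> S4" "c \<in> {-1, 1}" for v c
    using that
    by (intro spins.AE_infinitely_often[where q = "1 / 2"])
      (auto simp: inj_def measure_spin_measure_1 measure_spin_measure_minus_1)
  then have "AE w in ?M. \<forall>v\<in>S4. infinite {n. w (v, n) = -1} \<and> infinite {n. w (v, n) = 1}"
    by (subst AE_ball_countable) auto
  ultimately have "AE w in ?M. \<forall>v\<in>S4. (\<forall>n. w (v, n) \<in> {-1, 1}) \<and>
      infinite {n. w (v, n) = -1} \<and> infinite {n. w (v, n) = 1}"
    by eventually_elim auto
  from AE_glauber_coins[OF this] show ?thesis
    by (simp add: coin_def)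
qed

lemma AE_initial_spin: "AE \<omega> in glauber_measure p. \<forall>v\<in>S4. initial_spin \<omega> v \<in> {-1, 1}"
proof -
  have "AE s in \<Pi>\<^sub>M v\<in>S4. spin_measure p. \<forall>v\<in>S4. s v \<in> {-1, 1}"
    by (subst AE_ball_countable) (auto intro!: spins.AE_component AE_spin_measure simp del: insert_iff)
  from AE_glauber_spins[OF this] show ?thesis
    by (simp add: initial_spin_def)
qed

text \<open>The value 0 means no constraint. Each \<open>\<phi> n\<close> is realized with
  probability at least \<open>(min p (1 - p)) ^ k\<close>, and disjoint supports make these events
  independent.\<close>

lemma AE_ex_initial_pattern:
  fixes \<phi> :: "nat \<Rightarrow> site \<Rightarrow> int"
  assumes p: "0 < p" "p < 1"
    and \<phi>: "\<And>n v. \<phi> n v \<noteq> 0 \<Longrightarrow> v \<in> S4" "\<And>n v. \<phi> n v \<in> {-1, 0, 1}"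
    and fin: "\<And>n. finite {v. \<phi> n v \<noteq> 0}" "\<And>n. card {v. \<phi> n v \<noteq> 0} \<le> k"
    and disj: "disjoint_family (\<lambda>n. {v. \<phi> n v \<noteq> 0})"
  shows "AE \<omega> in glauber_measure p. \<exists>n. \<forall>v. \<phi> n v \<noteq> 0 \<longrightarrow> initial_spin \<omega> v = \<phi> n v"
proof -
  \<comment> \<open>The block lemma takes one requirement per site, common to all blocks. At most
    one support contains \<open>v\<close>, so the choice is forced on the supports; elsewhere the
    value does not matter.\<close>
  define A where "A v = {\<phi> (SOME n. \<phi> n v \<noteq> 0) v}" for v
  have A: "A v = {\<phi> n v}" if "\<phi> n v \<noteq> 0" for n v
  proof -
    have "\<phi> (SOME n. \<phi> n v \<noteq> 0) v \<noteq> 0" using that by (rule someI)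
    then have "(SOME n. \<phi> n v \<noteq> 0) = n"
      using disj that by (auto simp: disjoint_family_on_def)
    then show ?thesis by (simp add: A_def)
  qed
  let ?q = "min p (1 - p)"
  have "?q ^ k \<le> (\<Prod>v\<in>{v. \<phi> n v \<noteq> 0}. measure (spin_measure p) (A v))" for n
  proof -
    have "?q ^ k \<le> ?q ^ card {v. \<phi> n v \<noteq> 0}"
      using p fin by (intro power_decreasing) auto
    also have "\<dots> = (\<Prod>v\<in>{v. \<phi> n v \<noteq> 0}. ?q)" by simp
    also have "\<dots> \<le> (\<Prod>v\<in>{v. \<phi> n v \<noteq> 0}. measure (spin_measure p) (A v))"
    proof (intro prod_mono conjI)
      fix v assume "v \<in> {v. \<phi> n v \<noteq> 0}"
      then show "?q \<le> measure (spin_measure p) (A v)"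
        using p \<phi>(2)[of n v] A[of n v]
        by (auto simp: measure_spin_measure_1 measure_spin_measure_minus_1)
    qed (use p in auto)
    finally show ?thesis .
  qed
  then have "AE s in \<Pi>\<^sub>M v\<in>S4. spin_measure p. \<exists>n. \<forall>v\<in>{v. \<phi> n v \<noteq> 0}. s v \<in> A v"
    using p \<phi>(1) fin disj by (intro spins.AE_ex_block[where q = "?q ^ k"]) auto
  then have "AE s in \<Pi>\<^sub>M v\<in>S4. spin_measure p. \<exists>n. \<forall>v. \<phi> n v \<noteq> 0 \<longrightarrow> s v = \<phi> n v"
    by eventually_elim (use A in auto)
  from AE_glauber_spins[OF this] show ?thesis
    by (simp add: initial_spin_def)
qed

section \<open>Trajectories\<close>

text \<open>Induction over real time along a locally finite set \<open>A\<close> of events, by the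
  number of events strictly between 0 and \<open>t\<close>. A step crosses an interval without
  events inside; an event at \<open>t\<close> itself is allowed.\<close>

lemma discrete_time_induct [consumes 1, case_names finite zero step]:
  fixes A :: "real set"
  assumes "0 \<le> t"
    and fin: "\<And>t. finite (A \<inter> {..t})"
    and zero: "P 0"
    and step: "\<And>s t. 0 \<le> s \<Longrightarrow> s < t \<Longrightarrow> A \<inter> {s<..<t} = {} \<Longrightarrow> P s \<Longrightarrow> P t"
  shows "P t"
  using assms(1)
proof (induction "card (A \<inter> {0<..<t})" arbitrary: t rule: less_induct)
  case less
  have fin': "finite (A \<inter> {0<..<t})" for t
    by (rule finite_subset[OF _ fin[of t]]) auto
  show ?case
  proof (cases "A \<inter> {0<..<t} = {}")
    case True
    then show ?thesis using zero step[of 0 t] less.prems by (cases "t = 0") auto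
  next
    case False
    \<comment> \<open>The last event before \<open>t\<close>; since \<open>s\<close> does not count
      itself, fewer events precede it.\<close>
    define s where "s = Max (A \<inter> {0<..<t})"
    have s: "s \<in> A \<inter> {0<..<t}" unfolding s_def using fin' False by (rule Max_in)
    have "r \<le> s" if "r \<in> A \<inter> {0<..<t}" for r unfolding s_def using fin' that by (rule Max_ge)
    with s have "A \<inter> {s<..<t} = {}" by force
    moreover have "card (A \<inter> {0<..<s}) < card (A \<inter> {0<..<t})"
      using s by (intro psubset_card_mono fin') auto
    ultimately show ?thesis using less.hyps[of s] step[of s t] s by simp
  qed
qed

section \<open>The six neighbours of a site and the sign of its energy\<close>

lemma abs_sum_eq_1_iff:
  fixes a b c :: int
  shows "\<bar>a\<bar> + \<bar>b\<bar> + \<bar>c\<bar> = 1 \<longleftrightarrow>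
    \<bar>a\<bar> = 1 \<and> b = 0 \<and> c = 0 \<or> a = 0 \<and> \<bar>b\<bar> = 1 \<and> c = 0 \<or> a = 0 \<and> b = 0 \<and> \<bar>c\<bar> = 1"
proof -
  have "p + q + r = 1 \<longleftrightarrow> p = 1 \<and> q = 0 \<and> r = 0 \<or> p = 0 \<and> q = 1 \<and> r = 0 \<or> p = 0 \<and> q = 0 \<and> r = 1"
    if "0 \<le> p" "0 \<le> q" "0 \<le> r" for p q r :: int
    using that by linarith
  from this[of "\<bar>a\<bar>" "\<bar>b\<bar>" "\<bar>c\<bar>"] show ?thesis by simp
qed

text \<open>An explicit list lets cardinalities and energies be computed by unfolding. The last
  entry is the step by -1 in the periodic direction.\<close>

definition neighbours :: "site \<Rightarrow> site list" where
  "neighbours v = (case v of (x, y, z) \<Rightarrow>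
    [(x + 1, y, z), (x - 1, y, z), (x, y + 1, z), (x, y - 1, z), (x, y, (z + 1) mod 4), (x, y, (z + 3) mod 4)])"

lemma set_neighbours:
  assumes "v \<in> S4"
  shows "set (neighbours v) = {w. adj v w}"
proof -
  obtain x y z where v: "v = (x, y, z)" by (cases v)
  have z: "z \<in> {0, 1, 2, 3}" using assms v by (simp add: S4_def)
  have "adj (x, y, z) (x', y', z') \<longleftrightarrow>
    z' = z \<and> (y' = y \<and> (x' = x + 1 \<or> x' = x - 1) \<or> x' = x \<and> (y' = y + 1 \<or> y' = y - 1)) \<or>
    x' = x \<and> y' = y \<and> (z' = (z + 1) mod 4 \<or> z' = (z + 3) mod 4)" for x' y' z'
  proof -
    have 1: "\<bar>u - u'\<bar> = 1 \<longleftrightarrow> u' = u + 1 \<or> u' = u - 1" "u - u' = 0 \<longleftrightarrow> u' = u" for u u' :: int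
      by auto
    \<comment> \<open>Unit steps in the third coordinate and the two wrap-around edges together are
      the steps by 1 and -1 modulo 4.\<close>
    have 2: "z' \<in> {0, 1, 2, 3} \<and> (z' = z + 1 \<or> z' = z - 1 \<or> z = 3 \<and> z' = 0 \<or> z = 0 \<and> z' = 3) \<longleftrightarrow>
        z' = (z + 1) mod 4 \<or> z' = (z + 3) mod 4"
    proof -
      from z consider "z = 0" | "z = 1" | "z = 2" | "z = 3" by blast
      then show ?thesis by cases auto
    qed
    show ?thesis
      unfolding adj_def S4_def prod.case abs_sum_eq_1_iff 1 2[symmetric]
      using z by (cases "z' = z"; cases "x' = x"; cases "y' = y"; simp)
  qed
  then show ?thesis unfolding v neighbours_def prod.case by (intro set_eqI) (simp add: split_paired_all, blast)
qed

lemma distinct_neighbours: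
  assumes "v \<in> S4"
  shows "distinct (neighbours v)"
proof -
  obtain x y z where v: "v = (x, y, z)" by (cases v)
  have "z \<in> {0, 1, 2, 3}" using assms v by (simp add: S4_def)
  then have "z \<noteq> (z + 1) mod 4" "z \<noteq> (z + 3) mod 4" "(z + 1) mod 4 \<noteq> (z + 3) mod 4"
    by auto
  then show ?thesis by (auto simp: v neighbours_def)
qed

lemma card_adj_filter:
  assumes "v \<in> S4"
  shows "card {w. adj v w \<and> P w} = length (filter P (neighbours v))"
proof -
  have "{w. adj v w \<and> P w} = set (filter P (neighbours v))"
    using set_neighbours[OF assms] by auto
  then show ?thesis
    using distinct_card[of "filter P (neighbours v)"] distinct_neighbours[OF assms] by simp
qed

lemma
  assumes "v \<in> S4"
  shows finite_neighbours: "finite {w. adj v w}"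
    and card_neighbours: "card {w. adj v w} = 6"
proof -
  show "finite {w. adj v w}" unfolding set_neighbours[OF assms, symmetric] by simp
  show "card {w. adj v w} = 6"
    using card_adj_filter[OF assms, of "\<lambda>_. True"] by (simp add: neighbours_def split: prod.split)
qed

lemma energy_eq_sum_list:
  assumes "v \<in> S4"
  shows "energy \<eta> v = - (\<Sum>w\<leftarrow>neighbours v. \<eta> v * \<eta> w)"
  unfolding energy_def set_neighbours[OF assms, symmetric]
  by (simp add: sum_list_distinct_conv_sum_set distinct_neighbours[OF assms])

lemma adj_S4: "adj v w \<Longrightarrow> v \<in> S4 \<and> w \<in> S4"
  by (simp add: adj_def)

lemma energy_cong:
  assumes "\<eta> v = \<eta>' v" "\<And>w. adj v w \<Longrightarrow> \<eta> w = \<eta>' w"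
  shows "energy \<eta> v = energy \<eta>' v"
  using assms by (simp add: energy_def)

text \<open>Four of the six neighbours agree and at most two disagree, so the products of spins sum
  to at least 2.\<close>

lemma energy_neg:
  assumes v: "v \<in> S4" "\<eta> v \<in> {-1, 1}" and pm: "\<And>w. adj v w \<Longrightarrow> \<eta> w \<in> {-1, 1}"
    and four: "4 \<le> card {w. adj v w \<and> \<eta> w = \<eta> v}"
  shows "energy \<eta> v < 0"
proof -
  let ?N = "{w. adj v w}" and ?E = "{w. adj v w \<and> \<eta> w = \<eta> v}"
  have fin: "finite ?N" using v(1) by (rule finite_neighbours)
  have "(\<Sum>w\<in>?N. \<eta> v * \<eta> w) = (\<Sum>w\<in>?N. if \<eta> w = \<eta> v then 2 else 0) - (\<Sum>w\<in>?N. 1)"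
    unfolding sum_subtractf[symmetric] using v pm by (intro sum.cong) fastforce+
  also have "(\<Sum>w\<in>?N. if \<eta> w = \<eta> v then 2 else 0) = 2 * int (card ?E)"
    using fin by (simp add: sum.If_cases Int_def mult.commute)
  finally show ?thesis
    using four card_neighbours[OF v(1)] by (simp add: energy_def)
qed

section \<open>Deterministic analysis of a single trajectory\<close>

text \<open>Collects the almost sure properties of a realization, so that the arguments about its
  trajectory involve no probability.\<close>

locale regular_trajectory =
  fixes \<omega> :: realization and \<sigma> :: "real \<Rightarrow> site \<Rightarrow> int"
  assumes trajectory: "glauber_trajectory \<omega> \<sigma>"
    and finite_rings: "v \<in> S4 \<Longrightarrow> finite {n. ring_time \<omega> v n \<le> t}"
    and initial_pm: "v \<in> S4 \<Longrightarrow> initial_spin \<omega> v \<in> {-1, 1}"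
    and coin_pm: "v \<in> S4 \<Longrightarrow> coin \<omega> v n \<in> {-1, 1}"
    and infinite_coin: "v \<in> S4 \<Longrightarrow> c \<in> {-1, 1} \<Longrightarrow> infinite {n. coin \<omega> v n = c}"
begin

lemma spin_0: "v \<in> S4 \<Longrightarrow> \<sigma> 0 v = initial_spin \<omega> v"
  using trajectory by (simp add: glauber_trajectory_def)

lemma spin_ring:
  "v \<in> S4 \<Longrightarrow> \<sigma> (ring_time \<omega> v n) v = update (before \<sigma> (ring_time \<omega> v n)) (coin \<omega> v n) v"
  using trajectory by (simp add: glauber_trajectory_def)

lemma spin_const:
  assumes "v \<in> S4" "0 \<le> s" "s \<le> t" "range (ring_time \<omega> v) \<inter> {s<..t} = {}"
  shows "\<sigma> t v = \<sigma> s v"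
proof -
  have "\<forall>n. ring_time \<omega> v n \<notin> {s<..t}" using assms(4) by blast
  then show ?thesis using trajectory assms by (simp add: glauber_trajectory_def)
qed

lemma before_eq:
  assumes "s < t" "\<And>r. s < r \<Longrightarrow> r < t \<Longrightarrow> \<sigma> r v = c"
  shows "before \<sigma> t v = c"
proof -
  have "eventually (\<lambda>r. \<sigma> r v = c) (at_left t)"
    using eventually_at_left_real[OF assms(1)] by eventually_elim (use assms(2) in auto)
  then have "((\<lambda>r. \<sigma> r v) \<longlongrightarrow> c) (at_left t)" by (rule tendsto_eventually)
  then show ?thesis unfolding before_def by (intro tendsto_Lim) simp_all
qed

lemma before_const:
  assumes "v \<in> S4" "0 \<le> s" "s < t" "range (ring_time \<omega> v) \<inter> {s<..<t} = {}"
  shows "before \<sigma> t v = \<sigma> s v"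
  using assms by (intro before_eq[of s] spin_const) fastforce+

lemma finite_ring_times:
  assumes "finite R" "R \<subseteq> S4"
  shows "finite ((\<Union>v\<in>R. range (ring_time \<omega> v)) \<inter> {..t})"
proof -
  have "(\<Union>v\<in>R. range (ring_time \<omega> v)) \<inter> {..t} = (\<Union>v\<in>R. ring_time \<omega> v ` {n. ring_time \<omega> v n \<le> t})"
    by auto
  also have "finite \<dots>" using assms finite_rings by (intro finite_UN_I finite_imageI) auto
  finally show ?thesis .
qed

text \<open>Either \<open>t\<close> is itself a ring of \<open>v\<close>, or \<open>{s<..t}\<close>
  contains no ring and the spin has not moved.\<close>

lemma spin_step:
  assumes v: "v \<in> S4" and st: "0 \<le> s" "s < t"
    and R: "range (ring_time \<omega> v) \<inter> {s<..<t} = {}"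
  obtains "\<sigma> t v = \<sigma> s v" | n where "t = ring_time \<omega> v n" "\<sigma> t v = update (before \<sigma> t) (coin \<omega> v n) v"
proof (cases "t \<in> range (ring_time \<omega> v)")
  case True
  then show ?thesis using spin_ring[OF v] that(2) by blast
next
  case False
  with R have "r \<notin> range (ring_time \<omega> v)" if "s < r" "r \<le> t" for r
    using that by (cases "r = t") auto
  then have "range (ring_time \<omega> v) \<inter> {s<..t} = {}" by (meson disjoint_iff greaterThanAtMost_iff)
  then show ?thesis using spin_const[OF v, of s t] st that(1) by simp
qed

lemma spin_pm:
  assumes v: "v \<in> S4" and t: "0 \<le> t"
  shows "\<sigma> t v \<in> {-1, 1}"
  using t
proof (induction t rule: discrete_time_induct[where A = "range (ring_time \<omega> v)"])
  case (finite t)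
  then show ?case using finite_ring_times[of "{v}" t] v by simp
next
  case zero
  then show ?case using spin_0 initial_pm v by simp
next
  case (step s t)
  have "before \<sigma> t v = \<sigma> s v" using v step.hyps by (rule before_const)
  then show ?case
    using step.IH coin_pm[OF v] by (cases rule: spin_step[OF v step.hyps(1-3)]) (auto simp: update_def)
qed

text \<open>As long as all signed sites keep their spins, each agrees with at least four of its six
  neighbours, so its energy is negative and a ring does not change it.\<close>

lemma frozen:
  fixes \<phi> :: "site \<Rightarrow> int"
  assumes fin: "finite {v. \<phi> v \<noteq> 0}" and S4: "\<And>v. \<phi> v \<noteq> 0 \<Longrightarrow> v \<in> S4"
    and four: "\<And>v. \<phi> v \<noteq> 0 \<Longrightarrow> 4 \<le> card {w. adj v w \<and> \<phi> w = \<phi> v}"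
    and init: "\<And>v. \<phi> v \<noteq> 0 \<Longrightarrow> initial_spin \<omega> v = \<phi> v"
    and t: "0 \<le> t" and v: "\<phi> v \<noteq> 0"
  shows "\<sigma> t v = \<phi> v"
proof -
  \<comment> \<open>The energies of signed sites involve their neighbours, so these are tracked too.
    As \<open>R\<close> is finite, its ring times are locally finite and can serve as the events of
    the induction.\<close>
  define R where "R = {v. \<phi> v \<noteq> 0} \<union> (\<Union>v\<in>{v. \<phi> v \<noteq> 0}. {w. adj v w})"
  have R: "finite R" "R \<subseteq> S4"
    unfolding R_def using fin S4 finite_neighbours adj_S4 by blast+
  from t have "\<forall>v. \<phi> v \<noteq> 0 \<longrightarrow> \<sigma> t v = \<phi> v"
  proof (induction t rule: discrete_time_induct[where A = "\<Union>v\<in>R. range (ring_time \<omega> v)"])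
    case (finite t)
    show ?case using R by (rule finite_ring_times)
  next
    case zero
    then show ?case using spin_0 S4 init by simp
  next
    case (step s t)
    have noring: "range (ring_time \<omega> w) \<inter> {s<..<t} = {}" if "w \<in> R" for w
      using step.hyps(3) that by blast
    have before: "before \<sigma> t w = \<sigma> s w" if "w \<in> R" for w
      using that R step.hyps noring by (intro before_const) auto
    show ?case
    proof (intro allI impI)
      fix v assume v: "\<phi> v \<noteq> 0"
      then have vR: "v \<in> R" "v \<in> S4" using S4 by (auto simp: R_def)
      have nR: "w \<in> R" "w \<in> S4" if "adj v w" for w
        using that v adj_S4[OF that] unfolding R_def by blast+
      have sv: "\<sigma> s v = \<phi> v" using step.IH v by blast
      \<comment> \<open>Neighbours where \<open>\<phi>\<close> vanishes have unknown spins, but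
        these can only enlarge the agreeing set.\<close>
      have "{w. adj v w \<and> \<phi> w = \<phi> v} \<subseteq> {w. adj v w \<and> \<sigma> s w = \<sigma> s v}"
        using step.IH sv v by fastforce
      from card_mono[OF _ this] have "card {w. adj v w \<and> \<phi> w = \<phi> v} \<le> card {w. adj v w \<and> \<sigma> s w = \<sigma> s v}"
        using finite_neighbours[OF vR(2)] by simp
      then have "energy (\<sigma> s) v < 0"
        using four[OF v] spin_pm step.hyps vR nR by (intro energy_neg) auto
      moreover have "energy (before \<sigma> t) v = energy (\<sigma> s) v"
        using before vR nR by (intro energy_cong) auto
      ultimately show "\<sigma> t v = \<phi> v"
        using sv before[OF vR(1)]
        by (cases rule: spin_step[OF vR(2) step.hyps(1,2) noring[OF vR(1)]]) (auto simp: update_def)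
    qed
  qed
  with v show ?thesis by blast
qed

text \<open>If the energy were nonnegative, a ring after \<open>T\<close> with coin
  \<open>- \<eta> v\<close> would reverse the spin, by the flip rule or by the coin, against
  constancy.\<close>

lemma limit_energy_neg:
  assumes v: "v \<in> S4" and T: "0 \<le> T" and \<eta>: "\<eta> v \<in> {-1, 1}"
    and const: "\<And>w t. w = v \<or> adj v w \<Longrightarrow> T \<le> t \<Longrightarrow> \<sigma> t w = \<eta> w"
  shows "energy \<eta> v < 0"
proof (rule ccontr)
  assume nonneg: "\<not> energy \<eta> v < 0"
  have "infinite {n. coin \<omega> v n = - \<eta> v}" using v \<eta> by (intro infinite_coin) auto
  \<comment> \<open>Only finitely many rings happen up to \<open>T\<close>, while this coin value
    occurs at infinitely many rings.\<close>
  with finite_rings[OF v, of T] have "infinite ({n. coin \<omega> v n = - \<eta> v} - {n. ring_time \<omega> v n \<le> T})"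
    by (rule Diff_infinite_finite)
  then have "{n. coin \<omega> v n = - \<eta> v} - {n. ring_time \<omega> v n \<le> T} \<noteq> {}"
    by (rule infinite_imp_nonempty)
  then obtain n where n: "coin \<omega> v n = - \<eta> v" "T < ring_time \<omega> v n"
    unfolding ex_in_conv[symmetric] by (auto simp: not_le)
  let ?t = "ring_time \<omega> v n"
  have before: "before \<sigma> ?t w = \<eta> w" if "w = v \<or> adj v w" for w
    using const that n(2) by (intro before_eq[of T]) auto
  then have "energy (before \<sigma> ?t) v = energy \<eta> v" by (intro energy_cong) auto
  with nonneg before n(1) have "\<sigma> ?t v = - \<eta> v"
    unfolding spin_ring[OF v] by (auto simp: update_def)
  moreover have "\<sigma> ?t v = \<eta> v" using const n(2) by simp
  ultimately show False using \<eta> by auto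
qed

text \<open>The finitely many sites of \<open>B\<close> and their neighbours have a common time
  \<open>T\<close> after which none of them changes, so \<open>\<sigma> T\<close> is their
  limit.\<close>

lemma fixates_imp_energy_neg:
  assumes B: "finite B" "B \<subseteq> S4" and fixates: "\<And>v. v \<in> S4 \<Longrightarrow> fixates \<sigma> v"
  obtains T where "0 \<le> T" "\<And>v. v \<in> B \<Longrightarrow> energy (\<sigma> T) v < 0"
proof -
  define R where "R = B \<union> (\<Union>v\<in>B. {w. adj v w})"
  have R: "finite R" "R \<subseteq> S4"
    unfolding R_def using B finite_neighbours adj_S4 by blast+
  obtain \<tau> where \<tau>: "\<And>v. v \<in> S4 \<Longrightarrow> 0 \<le> \<tau> v \<and> (\<forall>t\<ge>\<tau> v. \<sigma> t v = \<sigma> (\<tau> v) v)"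
    using fixates unfolding fixates_def by metis
  define T where "T = Max (insert 0 (\<tau> ` R))"
  have T: "0 \<le> T" "\<And>v. v \<in> R \<Longrightarrow> \<tau> v \<le> T" using R by (auto simp: T_def)
  have const: "\<sigma> t v = \<sigma> T v" if "v \<in> R" "T \<le> t" for v t
  proof -
    have "\<tau> v \<le> t" using T(2)[OF that(1)] that(2) by simp
    then show ?thesis using \<tau>[of v] T(2)[of v] that R by (metis subsetD)
  qed
  have "energy (\<sigma> T) v < 0" if "v \<in> B" for v
  proof (rule limit_energy_neg)
    show "v \<in> S4" using that B by blast
    then show "\<sigma> T v \<in> {-1, 1}" using T(1) by (rule spin_pm)
    show "\<sigma> t w = \<sigma> T w" if "w = v \<or> adj v w" "T \<le> t" for w t
    proof (rule const)
      show "w \<in> R" using that \<open>v \<in> B\<close> unfolding R_def by blast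
    qed fact
  qed fact
  with T(1) show ?thesis by (rule that)
qed

end

section \<open>A pattern with blinking sites\<close>

text \<open>
  The four layers \<open>z = 0, 1, 2, 3\<close> of a pattern found by a SAT solver; \<open>x\<close> indexes the lines and
  \<open>y\<close> the characters of a line. Every signed site has at least four equally signed neighbours, so
  the signed sites are frozen whatever happens at the sites marked by a dot. The four sites
  \<open>(3, 3, 0), \<dots>, (6, 3, 0)\<close> form a segment with a frozen plus at one end and a frozen minus at
  the other, and the contributions of their remaining neighbours cancel.
\<close>

definition layers :: "string list list" where
  "layers =
    [[''---------'',
      ''-+++--++-'',
      ''-+++--++-'',
      ''-++.--++-'',
      ''-++.--++-'',
      ''-++.--++-'',
      ''-++.--++-'',
      ''---------'',
      ''---------'',
      ''-+++++++-'',
      ''-+++++++-'',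
      ''---------''],
     [''---------'',
      ''-+++--++-'',
      ''-+++--++-'',
      ''---------'',
      ''---------'',
      ''-++---++-'',
      ''-++---++-'',
      ''---------'',
      ''---------'',
      ''-++--+++-'',
      ''-++--+++-'',
      ''---------''],
     [''---------'',
      ''-+++++++-'',
      ''-+++++++-'',
      ''---------'',
      ''---------'',
      ''-++--.++-'',
      ''-++--.++-'',
      ''-++--.++-'',
      ''-++--.++-'',
      ''-++--+++-'',
      ''-++--+++-'',
      ''---------''],
     [''---------'',
      ''-+++++++-'',
      ''-+++++++-'',
      ''-+++++++-'',
      ''-+++++++-'',
      ''-+++++++-'',
      ''-+++++++-'',
      ''-+++++++-'',
      ''-+++++++-'',
      ''-+++++++-'',
      ''-+++++++-'',
      ''---------'']]"

text \<open>Zero rows outside the box give all rows length 9, so that comparisons across the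
  boundary make sense.\<close>

definition pattern_row :: "int \<Rightarrow> int \<Rightarrow> int list" where
  "pattern_row x z =
    (if 0 \<le> x \<and> x < 12 \<and> 0 \<le> z \<and> z < 4
     then map (\<lambda>c. if c = CHR ''+'' then 1 else if c = CHR ''-'' then -1 else 0) (layers ! nat z ! nat x)
     else replicate 9 0)"

definition pattern :: "site \<Rightarrow> int" where
  "pattern v = (case v of (x, y, z) \<Rightarrow> if 0 \<le> y \<and> y < 9 then pattern_row x z ! nat y else 0)"

text \<open>
  A row is compared with the rows of its six neighbours; in \<open>y\<close>-direction these are the row
  itself, shifted by one.
\<close>

fun row_stable :: "int list \<Rightarrow> int list \<Rightarrow> int list \<Rightarrow> int list \<Rightarrow> int list \<Rightarrow> int list \<Rightarrow> int list \<Rightarrow> bool" where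
  "row_stable (c # cs) (e # es) (w # ws) (n # ns) (s # ss) (u # us) (d # ds) \<longleftrightarrow>
    (c = 0 \<or> 4 \<le> length (filter (\<lambda>a. a = c) [e, w, n, s, u, d])) \<and> row_stable cs es ws ns ss us ds"
| "row_stable _ _ _ _ _ _ _ \<longleftrightarrow> True"

text \<open>The lists follow the order of \<open>neighbours\<close>. Those built with
  \<open>tl\<close> and \<open>0 #\<close> hold the values at \<open>y + 1\<close> and
  \<open>y - 1\<close>; the surplus tenth entry of the latter is never compared.\<close>

definition pattern_row_stable :: "int \<Rightarrow> int \<Rightarrow> bool" where
  "pattern_row_stable x z \<longleftrightarrow>
    length (pattern_row x z) = 9 \<and> set (pattern_row x z) \<subseteq> {-1, 0, 1} \<and>
    row_stable (pattern_row x z) (pattern_row (x + 1) z) (pattern_row (x - 1) z)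
      (tl (pattern_row x z) @ [0]) (0 # pattern_row x z)
      (pattern_row x ((z + 1) mod 4)) (pattern_row x ((z + 3) mod 4))"

text \<open>A finite check by evaluation of all 48 rows; explicit lists make the ranges
  executable.\<close>

lemma pattern_rows_check:
  "list_all (\<lambda>x. list_all (pattern_row_stable x) [0, 1, 2, 3]) [0, 1, 2, 3, 4, 5, 6, 7, 8, 9, 10, 11]"
  by code_simp

text \<open>The two ends of the segment and, for each of its sites, the four neighbours off the
  line: two plus and two minus.\<close>

lemma pattern_blinkers:
  "pattern (2, 3, 0) = 1" "pattern (7, 3, 0) = -1"
  "list_all (\<lambda>i. pattern (i, 2, 0) = 1 \<and> pattern (i, 4, 0) = -1 \<and> pattern (i, 3, 1) = -1 \<and> pattern (i, 3, 3) = 1)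
    [3, 4, 5, 6]"
  by code_simp+

lemma pattern_rows_stable:
  assumes "x \<in> {0..11}" "z \<in> {0..3}"
  shows "pattern_row_stable x z"
proof -
  have "{0..11 :: int} = set [0, 1, 2, 3, 4, 5, 6, 7, 8, 9, 10, 11]" "{0..3 :: int} = set [0, 1, 2, 3]"
    by (simp_all add: upto.simps flip: set_upto)
  with assms show ?thesis
    using pattern_rows_check unfolding list_all_iff by blast
qed

lemma pattern_row_outside: "\<not> (x \<in> {0..11} \<and> z \<in> {0..3}) \<Longrightarrow> pattern_row x z = replicate 9 0"
  unfolding pattern_row_def by (intro if_not_P) auto

lemma length_pattern_row: "length (pattern_row x z) = 9"
  using pattern_rows_stable[of x z] pattern_row_outside[of x z] unfolding pattern_row_stable_def
  by (metis length_replicate)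

lemma pattern_cases: "pattern v \<in> {-1, 0, 1}"
proof -
  have "set (pattern_row x z) \<subseteq> {-1, 0, 1}" for x z
    using pattern_rows_stable[of x z] pattern_row_outside[of x z] unfolding pattern_row_stable_def
    by (cases "x \<in> {0..11} \<and> z \<in> {0..3}") auto
  moreover have "pattern_row x z ! nat y \<in> set (pattern_row x z)" if "0 \<le> y" "y < 9" for x y z
    using that by (intro nth_mem) (simp add: length_pattern_row)
  ultimately have "pattern_row x z ! nat y \<in> {-1, 0, 1}" if "0 \<le> y" "y < 9" for x y z
    using that by blast
  then show ?thesis by (cases v) (simp add: pattern_def)
qed

lemma pattern_support: "{v. pattern v \<noteq> 0} \<subseteq> {0..11} \<times> {0..8} \<times> {0..3}"
proof
  fix v assume v: "v \<in> {v. pattern v \<noteq> 0}"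
  obtain x y z where xyz: "v = (x, y, z)" by (cases v)
  have y: "pattern_row x z ! nat y \<noteq> 0" "0 \<le> y" "y < 9"
    using v unfolding xyz pattern_def by (auto split: if_splits)
  have "x \<in> {0..11} \<and> z \<in> {0..3}"
  proof (rule ccontr)
    assume "\<not> ?thesis"
    from pattern_row_outside[OF this] y show False by simp
  qed
  with y show "v \<in> {0..11} \<times> {0..8} \<times> {0..3}" unfolding xyz by simp
qed

lemma row_stable_nth:
  assumes "row_stable cs es ws ns ss us ds"
    and "i < length cs" "i < length es" "i < length ws" "i < length ns" "i < length ss" "i < length us" "i < length ds"
    and "cs ! i \<noteq> 0"
  shows "4 \<le> length (filter (\<lambda>a. a = cs ! i) [es ! i, ws ! i, ns ! i, ss ! i, us ! i, ds ! i])"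
  using assms
proof (induction cs es ws ns ss us ds arbitrary: i rule: row_stable.induct)
  case (1 c cs e es w ws n ns s ss u us d ds)
  then show ?case by (cases i) (simp_all del: filter.simps)
qed simp_all

text \<open>Entry \<open>nat y\<close> of the seven compared rows gives the site and its six
  neighbours.\<close>

lemma pattern_stable:
  assumes "pattern v \<noteq> 0"
  shows "4 \<le> length (filter (\<lambda>w. pattern w = pattern v) (neighbours v))"
proof -
  obtain x y z where v: "v = (x, y, z)" by (cases v)
  have xyz: "x \<in> {0..11}" "0 \<le> y" "y \<le> 8" "z \<in> {0..3}"
    using assms pattern_support unfolding v by auto
  let ?i = "nat y"
  have i: "?i < 9" using xyz by simp
  have y: "pattern (x', y, z') = pattern_row x' z' ! ?i" for x' z' using xyz by (simp add: pattern_def)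
  \<comment> \<open>For \<open>y = 8\<close> the appended 0 is the value beyond the box; in the next
    fact the prepended 0 does the same for \<open>y = 0\<close>.\<close>
  have n: "pattern (x, y + 1, z) = (tl (pattern_row x z) @ [0]) ! ?i"
    using xyz by (auto simp: pattern_def nth_append nth_tl length_pattern_row nat_add_distrib)
  have s: "pattern (x, y - 1, z) = (0 # pattern_row x z) ! ?i"
    using xyz by (auto simp: pattern_def nth_Cons' nat_diff_distrib)
  have "row_stable (pattern_row x z) (pattern_row (x + 1) z) (pattern_row (x - 1) z)
      (tl (pattern_row x z) @ [0]) (0 # pattern_row x z)
      (pattern_row x ((z + 1) mod 4)) (pattern_row x ((z + 3) mod 4))"
    using xyz pattern_rows_stable unfolding pattern_row_stable_def by blast
  from row_stable_nth[OF this, of ?i]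
  have "4 \<le> length (filter (\<lambda>a. a = pattern (x, y, z)) (map pattern (neighbours (x, y, z))))"
    using i assms unfolding v neighbours_def prod.case list.map n s y
    by (simp add: length_pattern_row del: filter.simps)
  then show ?thesis unfolding v filter_map comp_def by simp
qed

section \<open>Translates of the pattern\<close>

definition shift :: "int \<Rightarrow> site \<Rightarrow> site" where
  "shift a v = (case v of (x, y, z) \<Rightarrow> (x + a, y, z))"

lemma shift_shift [simp]: "shift a (shift b v) = shift (a + b) v"
  by (simp add: shift_def split: prod.split)

lemma shift_0 [simp]: "shift 0 v = v"
  by (simp add: shift_def split: prod.split)

lemma shift_in_S4 [simp]: "shift a v \<in> S4 \<longleftrightarrow> v \<in> S4"
  by (cases v) (simp add: shift_def S4_def)

lemma neighbours_shift: "neighbours (shift a v) = map (shift a) (neighbours v)"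
  by (simp add: neighbours_def shift_def algebra_simps split: prod.split)

lemma translate_support: "{v. pattern (shift (- a) v) \<noteq> 0} = shift a ` {v. pattern v \<noteq> 0}"
proof (intro set_eqI iffI)
  fix v assume "v \<in> {v. pattern (shift (- a) v) \<noteq> 0}"
  then show "v \<in> shift a ` {v. pattern v \<noteq> 0}"
    by (intro image_eqI[of _ _ "shift (- a) v"]) simp_all
qed auto

lemma pattern_S4: "pattern v \<noteq> 0 \<Longrightarrow> v \<in> S4"
proof -
  have "{0..3} = {0, 1, 2, 3 :: int}" by auto
  then show "pattern v \<noteq> 0 \<Longrightarrow> v \<in> S4" using pattern_support unfolding S4_def by blast
qed

lemma finite_pattern: "finite {v. pattern v \<noteq> 0}"
  by (rule finite_subset[OF pattern_support]) simp

context regular_trajectory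
begin

lemma translate_frozen:
  assumes init: "\<And>v. pattern v \<noteq> 0 \<Longrightarrow> initial_spin \<omega> (shift a v) = pattern v"
    and "0 \<le> t" "pattern v \<noteq> 0"
  shows "\<sigma> t (shift a v) = pattern v"
proof -
  let ?\<phi> = "\<lambda>v. pattern (shift (- a) v)"
  have "\<sigma> t (shift a v) = ?\<phi> (shift a v)"
  proof (rule frozen)
    show "finite {v. ?\<phi> v \<noteq> 0}"
      unfolding translate_support using finite_pattern by (rule finite_imageI)
    fix v assume v: "?\<phi> v \<noteq> 0"
    from pattern_S4[OF this] show S4: "v \<in> S4" by simp
    show "initial_spin \<omega> v = ?\<phi> v" using init[OF v] by simp
    have "4 \<le> length (filter (\<lambda>w. pattern w = ?\<phi> v) (neighbours (shift (- a) v)))"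
      using v by (rule pattern_stable)
    then show "4 \<le> card {w. adj v w \<and> ?\<phi> w = ?\<phi> v}"
      unfolding card_adj_filter[OF S4] neighbours_shift filter_map comp_def by simp
  qed (use assms in simp_all)
  then show ?thesis by simp
qed

text \<open>Under fixation the contributions off the line cancel, so negative energy makes every
  segment site agree with both neighbours on the line. This would carry the plus at one end to the
  minus at the other.\<close>

lemma pattern_imp_not_fixates:
  assumes init: "\<And>v. pattern v \<noteq> 0 \<Longrightarrow> initial_spin \<omega> (shift a v) = pattern v"
  shows "\<exists>v\<in>S4. \<not> fixates \<sigma> v"
proof (rule ccontr)
  assume "\<not> (\<exists>v\<in>S4. \<not> fixates \<sigma> v)"
  \<comment> \<open>The segment consists of \<open>b 3\<close> to \<open>b 6\<close>;
    \<open>b 2\<close> and \<open>b 7\<close> are its frozen ends.\<close>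
  moreover define b where "b i = shift a (i, 3, 0)" for i
  have bS4: "b i \<in> S4" for i by (simp add: b_def) (simp add: S4_def)
  ultimately obtain T where T: "0 \<le> T" and neg: "\<And>v. v \<in> b ` {3..6} \<Longrightarrow> energy (\<sigma> T) v < 0"
    using fixates_imp_energy_neg[of "b ` {3..6}"] by blast
  define s where "s i = \<sigma> T (b i)" for i
  have frozen: "\<sigma> T (shift a v) = pattern v" if "pattern v \<noteq> 0" for v
    using init T that by (rule translate_frozen)
  have "set [3, 4, 5, 6 :: int] = {3..6}" by (simp add: upto.simps flip: set_upto)
  then have blinker: "pattern (i, 2, 0) = 1" "pattern (i, 4, 0) = -1" "pattern (i, 3, 1) = -1" "pattern (i, 3, 3) = 1"
    if "i \<in> {3..6}" for i
    using pattern_blinkers(3) that unfolding list_all_iff by blast+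
  have step: "s i * (s (i + 1) + s (i - 1)) > 0" if "i \<in> {3..6}" for i
  proof -
    have "energy (\<sigma> T) (b i) < 0" using neg that by simp
    then have "0 < (\<Sum>w\<leftarrow>neighbours (i, 3, 0). \<sigma> T (b i) * \<sigma> T (shift a w))"
      unfolding energy_eq_sum_list[OF bS4] by (simp add: b_def neighbours_shift comp_def)
    also have "\<dots> = s i * (s (i + 1) + s (i - 1))"
      using frozen[of "(i, 2, 0)"] frozen[of "(i, 4, 0)"] frozen[of "(i, 3, 1)"] frozen[of "(i, 3, 3)"]
        blinker[OF that]
      by (simp add: neighbours_def s_def b_def algebra_simps)
    finally show ?thesis .
  qed
  have pm: "s i \<in> {-1, 1}" for i unfolding s_def using bS4 T by (rule spin_pm)
  \<comment> \<open>A sum of two signs is nonzero only if they are equal, and positivity of the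
    product makes both equal to \<open>s i\<close>.\<close>
  have eq: "s i = s (i - 1)" if "i \<in> {3..6}" for i
    using step[OF that] pm[of i] pm[of "i - 1"] pm[of "i + 1"] by auto
  have "s 2 = 1" "s 7 = -1"
    using frozen[of "(2, 3, 0)"] frozen[of "(7, 3, 0)"] pattern_blinkers(1,2) by (simp_all add: s_def b_def)
  \<comment> \<open>The equalities carry \<open>s 2 = 1\<close> up to \<open>s 6\<close>, and
    \<open>step[of 6]\<close> then excludes \<open>s 7 = -1\<close>.\<close>
  with eq[of 3] eq[of 4] eq[of 5] eq[of 6] step[of 6] show False by simp
qed

end

theorem theorem1p2:
  fixes p :: real
    and \<sigma> :: "realization \<Rightarrow> real \<Rightarrow> site \<Rightarrow> int"
  assumes "0 < p" and "p < 1"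
    and "AE \<omega> in glauber_measure p. glauber_trajectory \<omega> (\<sigma> \<omega>)"
  shows "AE \<omega> in glauber_measure p. \<exists>v\<in>S4. \<not> fixates (\<sigma> \<omega>) v"
proof -
  \<comment> \<open>The pattern has extent 12 in the first coordinate, so shifts by multiples of 12
    have disjoint supports.\<close>
  let ?\<phi> = "\<lambda>(n :: nat) v. pattern (shift (- (12 * int n)) v)"
  have "AE \<omega> in glauber_measure p. \<exists>n. \<forall>v. ?\<phi> n v \<noteq> 0 \<longrightarrow> initial_spin \<omega> v = ?\<phi> n v"
  proof (rule AE_ex_initial_pattern)
    show "v \<in> S4" if "?\<phi> n v \<noteq> 0" for n v
      using pattern_S4[OF that] by simp
    show "finite {v. ?\<phi> n v \<noteq> 0}" for n
      unfolding translate_support using finite_pattern by (rule finite_imageI)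
    show "card {v. ?\<phi> n v \<noteq> 0} \<le> card {v. pattern v \<noteq> 0}" for n
      unfolding translate_support using finite_pattern by (rule card_image_le)
    have "m = n" if "?\<phi> m v \<noteq> 0" "?\<phi> n v \<noteq> 0" for m n v
    proof -
      have "fst v - 12 * int k \<in> {0..11}" if "?\<phi> k v \<noteq> 0" for k
        using that pattern_support by (cases v) (auto simp: shift_def)
      from this[OF that(1)] this[OF that(2)] show ?thesis by simp
    qed
    then show "disjoint_family (\<lambda>n. {v. ?\<phi> n v \<noteq> 0})"
      unfolding disjoint_family_on_def by blast
  qed (use assms(1,2) pattern_cases in blast)+
  \<comment> \<open>Outside a null set all these properties hold together, and the deterministic
    argument applies to the translate that occurs.\<close>
  with assms(3) AE_finite_rings AE_coins AE_initial_spin show ?thesis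
  proof eventually_elim
    case (elim \<omega>)
    then interpret regular_trajectory \<omega> "\<sigma> \<omega>"
      by unfold_locales auto
    obtain n where n: "\<And>v. ?\<phi> n v \<noteq> 0 \<Longrightarrow> initial_spin \<omega> v = ?\<phi> n v"
      using elim by blast
    show ?case
    proof (rule pattern_imp_not_fixates)
      show "initial_spin \<omega> (shift (12 * int n) v) = pattern v" if "pattern v \<noteq> 0" for v
        using n[of "shift (12 * int n) v"] that by simp
    qed
  qed
qed

end
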